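(* Let $n\geq 4$. Then there are exactly $8$ $F_n$-good matrices, and under matrix multiplication over $\mathbb{Z}_2$ they form a group isomorphic to the dihedral group $D_4$ of order $8$. For $n=3$, there are exactly $6$ $F_3$-good matrices, and under matrix multiplication they form a group isomorphic to the symmetric group $\mathfrak{S}_3$.
   Context: For $n\geq 1$, the Fibonacci cube $F_n$ is identified with the set of vectors $\vec{x}=(x_1,\ldots,x_n)\in\mathbb{Z}_2^n$ having no two adjacent ones, i.e. there is no $i$ with $1\leq i\leq n-1$ and $x_i=x_{i+1}=1$. An $n\times n$ matrix $A$ with entries in $\mathbb{Z}_2$ is called $F_n$-good if $A$ is invertible over $\mathbb{Z}_2$ and $A\vec{x}\in F_n$ for every $\vec{x}\in F_n$ (such matrices are the "linear permutations" of $F_n$). *)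

theory Defs
  imports "HOL-Library.Z2" "HOL-Algebra.Sym_Groups" "Jordan_Normal_Form.Matrix"
begin

definition fib_cube :: "nat \<Rightarrow> bit vec set" where
  "fib_cube n = {x \<in> carrier_vec n. \<forall>i. Suc i < n \<longrightarrow> \<not> (x $ i = 1 \<and> x $ Suc i = 1)}"

definition good_mat :: "nat \<Rightarrow> bit mat \<Rightarrow> bool" where
  "good_mat n A \<longleftrightarrow> A \<in> carrier_mat n n \<and> invertible_mat A \<and>
     (\<forall>x \<in> fib_cube n. A *\<^sub>v x \<in> fib_cube n)"

definition good_group :: "nat \<Rightarrow> bit mat monoid" where
  "good_group n = \<lparr> carrier = {A. good_mat n A}, mult = (*), one = 1\<^sub>m n \<rparr>"

definition square_edges :: "nat set set" where
  "square_edges = {{1,2},{2,3},{3,4},{4,1}}"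

definition dihedral4 :: "(nat \<Rightarrow> nat) monoid" where
  "dihedral4 = (sym_group 4)\<lparr> carrier :=
     {p. p permutes {1..4} \<and> (\<forall>e \<in> square_edges. p ` e \<in> square_edges)} \<rparr>"

end

theory Submission
  imports Defs
begin

text \<open>
  Describe a matrix by the supports \<open>S i\<close> of its rows (indices start at \<open>0\<close>). Testing on sums of at
  most two unit vectors shows that it preserves the Fibonacci cube iff every index in \<open>S i\<close> is a
  neighbour, in the path \<open>0, \<dots>, n - 1\<close>, of every index in \<open>S (i + 1)\<close>. Since \<open>S (i - 1) \<noteq> S (i + 1)\<close>,
  the interior supports are singletons, and they form a walk in the path that never turns back.
  Hence the interior rows are those of the identity or of the reversal, and the first and last row
  have some freedom: for \<open>n \<ge> 4\<close> the end forms are \<open>x\<^sub>0\<close> or \<open>x\<^sub>0 + x\<^sub>2\<close>, and symmetrically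
  at the other end; for \<open>n = 3\<close> they are any two distinct nonzero forms in \<open>x\<^sub>0, x\<^sub>2\<close>.
  Good matrices therefore correspond to permutations of the possible end forms. Substituting
  a matrix into forms reverses composition, so this correspondence is an anti-isomorphism,
  which is turned into an isomorphism by inverting.
\<close>

section \<open>The group of good matrices\<close>

text \<open>Vectors are encoded as lists of fixed length over a two-element type. Finiteness later
  turns injectivity on the cube into surjectivity.\<close>

lemma finite_carrier_vec_bit: "finite (carrier_vec n :: bit vec set)"
proof -
  have "(UNIV :: bit set) = {0, 1}"
    using bit_not_one_iff by blast
  then have "finite {xs :: bit list. set xs \<subseteq> UNIV \<and> length xs = n}"
    by (intro finite_lists_length_eq) (metis finite.emptyI finite.insertI)
  then have "finite (vec_of_list ` {xs :: bit list. set xs \<subseteq> UNIV \<and> length xs = n})"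
    by (rule finite_imageI)
  moreover have "(carrier_vec n :: bit vec set) \<subseteq> vec_of_list ` {xs. set xs \<subseteq> UNIV \<and> length xs = n}"
  proof
    fix v :: "bit vec" assume "v \<in> carrier_vec n"
    then have "v = vec_of_list (list_of_vec v)" "length (list_of_vec v) = n"
      by (auto simp: vec_list)
    then show "v \<in> vec_of_list ` {xs. set xs \<subseteq> UNIV \<and> length xs = n}"
      by blast
  qed
  ultimately show ?thesis
    using finite_subset by blast
qed

lemma finite_fib_cube: "finite (fib_cube n)"
  by (rule finite_subset[OF _ finite_carrier_vec_bit]) (auto simp: fib_cube_def)

text \<open>\<open>inverts_mat\<close> does not fix the shape of the inverse; it is recovered by
  comparing the column dimensions in both product equations.\<close>

lemma invertible_matD:
  assumes "invertible_mat A" "A \<in> carrier_mat n n"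
  obtains B where "B \<in> carrier_mat n n" "A * B = 1\<^sub>m n" "B * A = 1\<^sub>m n"
proof -
  obtain B where B: "A * B = 1\<^sub>m (dim_row A)" "B * A = 1\<^sub>m (dim_row B)"
    using assms unfolding invertible_mat_def inverts_mat_def by blast
  have "dim_col (A * B) = n" "dim_col (B * A) = dim_row B"
    using B assms by simp_all
  then have "B \<in> carrier_mat n n"
    using assms by auto
  with B assms show thesis
    by (intro that[of B]) auto
qed

lemma invertible_matI:
  assumes "A \<in> carrier_mat n n" "B \<in> carrier_mat n n" "A * B = 1\<^sub>m n" "B * A = 1\<^sub>m n"
  shows "invertible_mat A"
  using assms unfolding invertible_mat_def inverts_mat_def by auto

lemma good_mat_one: "good_mat n (1\<^sub>m n)"
  by (auto simp: good_mat_def fib_cube_def intro!: invertible_matI[of _ n "1\<^sub>m n"])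

lemma good_mat_mult:
  assumes "good_mat n A" "good_mat n B"
  shows "good_mat n (A * B)"
proof -
  have A: "A \<in> carrier_mat n n" and B: "B \<in> carrier_mat n n"
    using assms by (auto simp: good_mat_def)
  obtain A' where A': "A' \<in> carrier_mat n n" "A * A' = 1\<^sub>m n" "A' * A = 1\<^sub>m n"
    using assms A invertible_matD unfolding good_mat_def by metis
  obtain B' where B': "B' \<in> carrier_mat n n" "B * B' = 1\<^sub>m n" "B' * B = 1\<^sub>m n"
    using assms B invertible_matD unfolding good_mat_def by metis
  have "B * (B' * A') = A'"
    using assoc_mult_mat[OF B B'(1) A'(1)] A'(1) B'(2) by simp
  then have 1: "A * B * (B' * A') = 1\<^sub>m n"
    using assoc_mult_mat[OF A B mult_carrier_mat[OF B'(1) A'(1)]] A'(2) by simp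
  have "A' * (A * B) = B"
    using assoc_mult_mat[OF A'(1) A B] B A'(3) by simp
  then have 2: "B' * A' * (A * B) = 1\<^sub>m n"
    using assoc_mult_mat[OF B'(1) A'(1) mult_carrier_mat[OF A B]] B'(3) by simp
  have "invertible_mat (A * B)"
    by (rule invertible_matI[OF _ _ 1 2]) (use A B A' B' in auto)
  moreover have "A * B *\<^sub>v x \<in> fib_cube n" if "x \<in> fib_cube n" for x
  proof -
    have "A * B *\<^sub>v x = A *\<^sub>v (B *\<^sub>v x)"
      using that A B by (intro assoc_mult_mat_vec) (auto simp: fib_cube_def)
    then show ?thesis
      using that assms by (simp add: good_mat_def)
  qed
  ultimately show ?thesis
    using A B by (simp add: good_mat_def)
qed

text \<open>An injective self-map of the finite set \<^term>\<open>fib_cube n\<close> is onto, so the inverse matrix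
  preserves it too.\<close>

lemma good_mat_inverse:
  assumes "good_mat n A"
  obtains B where "good_mat n B" "B * A = 1\<^sub>m n"
proof -
  have A: "A \<in> carrier_mat n n"
    using assms by (auto simp: good_mat_def)
  obtain B where B: "B \<in> carrier_mat n n" "A * B = 1\<^sub>m n" "B * A = 1\<^sub>m n"
    using assms A invertible_matD unfolding good_mat_def by metis
  have BA: "B *\<^sub>v (A *\<^sub>v x) = x" if "x \<in> fib_cube n" for x
    using that A B assoc_mult_mat_vec[of B n n A n x] by (auto simp: fib_cube_def)
  have "(\<lambda>x. A *\<^sub>v x) ` fib_cube n = fib_cube n"
  proof (rule endo_inj_surj[OF finite_fib_cube])
    show "(\<lambda>x. A *\<^sub>v x) ` fib_cube n \<subseteq> fib_cube n"
      using assms by (auto simp: good_mat_def)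
    show "inj_on (\<lambda>x. A *\<^sub>v x) (fib_cube n)"
      by (metis BA inj_onI)
  qed
  then have "\<forall>y\<in>fib_cube n. B *\<^sub>v y \<in> fib_cube n"
    using BA by (metis imageE)
  moreover have "invertible_mat B"
    by (rule invertible_matI[OF B(1) A B(3,2)])
  ultimately show thesis
    using that B by (auto simp: good_mat_def)
qed

lemma group_good_group: "group (good_group n)"
proof (rule groupI)
  fix A B C assume "A \<in> carrier (good_group n)" "B \<in> carrier (good_group n)" "C \<in> carrier (good_group n)"
  then show "A \<otimes>\<^bsub>good_group n\<^esub> B \<otimes>\<^bsub>good_group n\<^esub> C = A \<otimes>\<^bsub>good_group n\<^esub> (B \<otimes>\<^bsub>good_group n\<^esub> C)"
    by (auto simp: good_group_def good_mat_def intro!: assoc_mult_mat)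
next
  fix A assume "A \<in> carrier (good_group n)"
  then show "\<exists>B\<in>carrier (good_group n). B \<otimes>\<^bsub>good_group n\<^esub> A = \<one>\<^bsub>good_group n\<^esub>"
    by (auto simp: good_group_def elim: good_mat_inverse)
next
  fix A assume "A \<in> carrier (good_group n)"
  then show "\<one>\<^bsub>good_group n\<^esub> \<otimes>\<^bsub>good_group n\<^esub> A = A"
    by (auto simp: good_group_def good_mat_def)
qed (auto simp: good_group_def good_mat_mult good_mat_one)

text \<open>Inversion is itself an anti-automorphism of a group, so following it by the inverse of
  \<open>f\<close> reverses the order of products twice. This composite is the isomorphism.\<close>

lemma (in group) anti_isomorphic_imp_iso:
  assumes bij: "bij_betw f (carrier H) (carrier G)"
    and closed: "\<And>x y. x \<in> carrier H \<Longrightarrow> y \<in> carrier H \<Longrightarrow> x \<otimes>\<^bsub>H\<^esub> y \<in> carrier H"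
    and anti: "\<And>x y. x \<in> carrier H \<Longrightarrow> y \<in> carrier H \<Longrightarrow> f (x \<otimes>\<^bsub>H\<^esub> y) = f y \<otimes> f x"
  shows "G \<cong> H"
proof -
  let ?g = "inv_into (carrier H) f"
  have g: "bij_betw ?g (carrier G) (carrier H)"
    by (rule bij_betw_inv_into[OF bij])
  have m: "bij_betw (m_inv G) (carrier G) (carrier G)"
    by (rule bij_betw_byWitness[where f' = "m_inv G"]) auto
  have fg: "f (?g x) = x" if "x \<in> carrier G" for x
    using bij that by (simp add: bij_betw_inv_into_right)
  have gc: "?g x \<in> carrier H" if "x \<in> carrier G" for x
    using g that by (auto simp: bij_betw_def)
  have "?g (inv (x \<otimes> y)) = ?g (inv x) \<otimes>\<^bsub>H\<^esub> ?g (inv y)"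
    if "x \<in> carrier G" "y \<in> carrier G" for x y
  proof -
    \<comment> \<open>Both sides of the goal lie in the domain of \<open>f\<close>, so it suffices
      to compare their images under \<open>f\<close>.\<close>
    have "f (?g (inv x) \<otimes>\<^bsub>H\<^esub> ?g (inv y)) = inv (x \<otimes> y)"
      using that by (simp add: anti gc fg inv_mult_group)
    then show ?thesis
      using that by (metis bij bij_betw_inv_into_left closed gc inv_closed)
  qed
  then have "?g \<circ> m_inv G \<in> iso G H"
    using bij_betw_trans[OF m g] by (auto simp: iso_def hom_def gc)
  then show ?thesis
    by (rule is_isoI)
qed

section \<open>Supports of the rows\<close>

text \<open>Over \<open>bit\<close> a linear functional is determined by its support, so a set of
  indices can stand for a functional.\<close>

definition form :: "nat set \<Rightarrow> bit vec \<Rightarrow> bit" where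
  "form T x = (\<Sum>j\<in>T. x $ j)"

definition row_mat :: "nat \<Rightarrow> (nat \<Rightarrow> nat set) \<Rightarrow> bit mat" where
  "row_mat n S = mat n n (\<lambda>(i, j). of_bool (j \<in> S i))"

text \<open>Every pair must be an edge of the path, so in particular the two sets are disjoint. The
  condition is vacuous if one of them is empty.\<close>

definition adjacent :: "nat set \<Rightarrow> nat set \<Rightarrow> bool" where
  "adjacent X Y \<longleftrightarrow> (\<forall>s\<in>X. \<forall>t\<in>Y. t = Suc s \<or> s = Suc t)"

lemma adjacentD: "adjacent X Y \<Longrightarrow> s \<in> X \<Longrightarrow> t \<in> Y \<Longrightarrow> t = Suc s \<or> s = Suc t"
  by (simp add: adjacent_def)

lemma adjacent_sym: "adjacent X Y \<longleftrightarrow> adjacent Y X"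
  by (auto simp: adjacent_def)

lemma row_mat_carrier [simp]: "row_mat n S \<in> carrier_mat n n"
  by (simp add: row_mat_def)

lemma row_mat_cong: "(\<And>i. i < n \<Longrightarrow> S i = T i) \<Longrightarrow> row_mat n S = row_mat n T"
  by (auto simp: row_mat_def)

lemma row_mat_eqD:
  assumes "row_mat n S = row_mat n T" "i < n" "S i \<subseteq> {..<n}" "T i \<subseteq> {..<n}"
  shows "S i = T i"
proof -
  have "j \<in> S i \<longleftrightarrow> j \<in> T i" if "j < n" for j
  proof -
    have "row_mat n S $$ (i, j) = row_mat n T $$ (i, j)"
      using assms(1) by simp
    then show ?thesis
      using that assms(2) by (auto simp: row_mat_def of_bool_def split: if_splits)
  qed
  then show ?thesis
    using assms(3,4) by auto
qed

lemma mat_eq_row_mat: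
  assumes "A \<in> carrier_mat n n"
  shows "A = row_mat n (\<lambda>i. {j. j < n \<and> A $$ (i, j) = 1})"
  by (rule eq_matI) (use assms in \<open>auto simp: row_mat_def\<close>)

lemma row_mat_mult_vec:
  assumes "S i \<subseteq> {..<n}" "i < n" "x \<in> carrier_vec n"
  shows "(row_mat n S *\<^sub>v x) $ i = form (S i) x"
proof -
  have "(row_mat n S *\<^sub>v x) $ i = (\<Sum>j\<in>{0..<n}. if j \<in> S i then x $ j else 0)"
  proof -
    have "(row_mat n S *\<^sub>v x) $ i = (\<Sum>j\<in>{0..<n}. row (row_mat n S) i $ j * x $ j)"
      using assms(2,3) by (simp add: row_mat_def scalar_prod_def del: index_row)
    also have "\<dots> = (\<Sum>j\<in>{0..<n}. if j \<in> S i then x $ j else 0)"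
      using assms(2) by (intro sum.cong) (auto simp: row_mat_def)
    finally show ?thesis .
  qed
  also have "\<dots> = (\<Sum>j\<in>{0..<n} \<inter> S i. x $ j)"
    by (simp add: sum.inter_restrict)
  also have "{0..<n} \<inter> S i = S i"
    using assms(1) by auto
  finally show ?thesis
    by (simp add: form_def)
qed

lemma form_unit_vec:
  assumes "T \<subseteq> {..<n}"
  shows "form T (unit_vec n j) = of_bool (j \<in> T)"
proof -
  have "form T (unit_vec n j) = (\<Sum>k\<in>T. if k = j then 1 else 0)"
    unfolding form_def using assms by (intro sum.cong) (auto simp: unit_vec_def)
  also have "\<dots> = of_bool (j \<in> T)"
    using assms finite_subset[OF assms] by simp
  finally show ?thesis .
qed

lemma form_add:
  assumes "T \<subseteq> {..<n}" "x \<in> carrier_vec n" "y \<in> carrier_vec n"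
  shows "form T (x + y) = form T x + form T y"
proof -
  have "form T (x + y) = (\<Sum>k\<in>T. x $ k + y $ k)"
    unfolding form_def using assms by (intro sum.cong) auto
  then show ?thesis
    by (simp only: form_def sum.distrib)
qed

lemma form_eq_1E:
  assumes "form T x = 1"
  obtains j where "j \<in> T" "x $ j = 1"
proof -
  have "\<exists>j\<in>T. x $ j \<noteq> 0"
  proof (rule ccontr)
    assume "\<not> (\<exists>j\<in>T. x $ j \<noteq> 0)"
    then have "form T x = 0"
      unfolding form_def by (intro sum.neutral) blast
    then show False
      using assms by simp
  qed
  then show thesis
    using that by auto
qed

text \<open>Multiplying matrices substitutes the forms of the right factor into those of the left.
  Unit vectors suffice for comparing entries, since their images are the columns.\<close>

lemma row_mat_mult:
  assumes S: "\<And>i. i < n \<Longrightarrow> S i \<subseteq> {..<n}" and T: "\<And>i. i < n \<Longrightarrow> T i \<subseteq> {..<n}"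
    and U: "\<And>i. i < n \<Longrightarrow> U i \<subseteq> {..<n}"
    and comp: "\<And>i x. i < n \<Longrightarrow> x \<in> carrier_vec n \<Longrightarrow>
      form (S i) (vec n (\<lambda>k. form (T k) x)) = form (U i) x"
  shows "row_mat n S * row_mat n T = row_mat n U"
proof (rule eq_matI)
  fix i j assume "i < dim_row (row_mat n U)" "j < dim_col (row_mat n U)"
  then have i: "i < n" and j: "j < n"
    by (auto simp: row_mat_def)
  have col: "col (row_mat n T) j = vec n (\<lambda>k. form (T k) (unit_vec n j))"
    using T j by (intro eq_vecI) (auto simp: form_unit_vec row_mat_def)
  have "(row_mat n S * row_mat n T) $$ (i, j) = (row_mat n S *\<^sub>v col (row_mat n T) j) $ i"
    using i j by (simp add: row_mat_def)
  also have "\<dots> = form (S i) (vec n (\<lambda>k. form (T k) (unit_vec n j)))"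
    unfolding col using i S by (intro row_mat_mult_vec) auto
  also have "\<dots> = form (U i) (unit_vec n j)"
    by (simp add: comp i)
  also have "\<dots> = row_mat n U $$ (i, j)"
    using i j U by (simp add: form_unit_vec row_mat_def)
  finally show "(row_mat n S * row_mat n T) $$ (i, j) = row_mat n U $$ (i, j)" .
qed (auto simp: row_mat_def)

text \<open>Two consecutive ones in the image would come from ones of \<open>x\<close> at some
  \<open>s\<close> in \<open>S i\<close> and \<open>t\<close> in \<open>S (Suc i)\<close>; these
  positions are adjacent, which the cube forbids.\<close>

lemma row_mat_preserves_fib_cube:
  assumes S: "\<And>i. i < n \<Longrightarrow> S i \<subseteq> {..<n}"
    and adj: "\<And>i. Suc i < n \<Longrightarrow> adjacent (S i) (S (Suc i))"
    and x: "x \<in> fib_cube n"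
  shows "row_mat n S *\<^sub>v x \<in> fib_cube n"
proof -
  have xc: "x \<in> carrier_vec n"
    using x by (simp add: fib_cube_def)
  have False
    if i: "Suc i < n" and 1: "(row_mat n S *\<^sub>v x) $ i = 1" "(row_mat n S *\<^sub>v x) $ Suc i = 1" for i
  proof -
    have "form (S i) x = 1" "form (S (Suc i)) x = 1"
      using row_mat_mult_vec[of S _ n x] S i 1 xc by auto
    then obtain s t where st: "s \<in> S i" "x $ s = 1" "t \<in> S (Suc i)" "x $ t = 1"
      by (metis form_eq_1E)
    moreover have "s < n" "t < n"
      using st S[of i] S[of "Suc i"] i by auto
    ultimately show False
      using adjacentD[OF adj[OF i] st(1,3)] x by (auto simp: fib_cube_def)
  qed
  then show ?thesis
    using xc mult_mat_vec_carrier[OF row_mat_carrier xc, of S] unfolding fib_cube_def by blast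
qed

text \<open>Single unit vectors show that consecutive supports are disjoint; sums of two unit
  vectors then exclude every pair that is not an edge.\<close>

lemma good_row_mat_adjacent:
  assumes S: "\<And>i. i < n \<Longrightarrow> S i \<subseteq> {..<n}" and good: "good_mat n (row_mat n S)" and i: "Suc i < n"
  shows "adjacent (S i) (S (Suc i))"
proof -
  have vanish: "\<not> (form (S i) x = 1 \<and> form (S (Suc i)) x = 1)" if "x \<in> fib_cube n" for x
  proof -
    have "row_mat n S *\<^sub>v x \<in> fib_cube n"
      using good that by (simp add: good_mat_def)
    then have "\<not> ((row_mat n S *\<^sub>v x) $ i = 1 \<and> (row_mat n S *\<^sub>v x) $ Suc i = 1)"
      using i by (auto simp: fib_cube_def)
    then show ?thesis
      using row_mat_mult_vec[of S _ n x] S i that by (auto simp: fib_cube_def)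
  qed
  have disj: "False" if "s \<in> S i" "s \<in> S (Suc i)" for s
  proof -
    have "unit_vec n s \<in> fib_cube n"
      using S[of i] i that by (auto simp: fib_cube_def unit_vec_def)
    then show False
      using vanish[of "unit_vec n s"] S i that by (auto simp: form_unit_vec)
  qed
  show ?thesis
    unfolding adjacent_def
  proof (intro ballI, rule ccontr)
    fix s t assume st: "s \<in> S i" "t \<in> S (Suc i)" and far: "\<not> (t = Suc s \<or> s = Suc t)"
    have n: "s < n" "t < n"
      using st S[of i] S[of "Suc i"] i by auto
    have "s \<noteq> t"
      using disj st by auto
    then have "unit_vec n s + unit_vec n t \<in> fib_cube n"
      using far n by (auto simp: fib_cube_def unit_vec_def)
    \<comment> \<open>By disjointness each of the two forms sees just one of the two unit vectors,
      so both forms take the value 1.\<close>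
    from vanish[OF this] show False
      using disj st S i by (auto simp: form_add[of _ n] form_unit_vec)
  qed
qed

lemma invertible_row_mat_nonempty:
  assumes "invertible_mat (row_mat n S)" "i < n"
  shows "S i \<noteq> {}"
proof
  assume e: "S i = {}"
  obtain B where B: "B \<in> carrier_mat n n" "row_mat n S * B = 1\<^sub>m n"
    using assms invertible_matD[OF _ row_mat_carrier] by metis
  have "(row_mat n S * B) $$ (i, i) = 0"
    using e B(1) assms(2) by (simp add: row_mat_def scalar_prod_def)
  then show False
    using B assms(2) by simp
qed

lemma invertible_row_mat_inj:
  assumes "invertible_mat (row_mat n S)" "i < n" "k < n" "S i = S k"
  shows "i = k"
proof (rule ccontr)
  assume ne: "i \<noteq> k"
  obtain B where B: "B \<in> carrier_mat n n" "row_mat n S * B = 1\<^sub>m n"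
    using assms invertible_matD[OF _ row_mat_carrier] by metis
  have "(row_mat n S * B) $$ (i, i) = (row_mat n S * B) $$ (k, i)"
    using assms(2-4) B(1) by (simp add: row_mat_def scalar_prod_def)
  then show False
    using B assms(2,3) ne by simp
qed

text \<open>The frame shared by both dimension ranges: \<open>N p\<close> lists the row supports of
  the matrix attached to the permutation \<open>p\<close>. Assumption \<open>comp\<close> says that
  substitution reverses composition, and the premises of \<open>surj\<close> are the facts about
  supports derived from goodness.\<close>

lemma good_group_iso:
  fixes N :: "(nat \<Rightarrow> nat) \<Rightarrow> nat \<Rightarrow> nat set"
  assumes mult: "mult H = (\<circ>)"
    and closed: "\<And>p q. p \<in> carrier H \<Longrightarrow> q \<in> carrier H \<Longrightarrow> p \<circ> q \<in> carrier H"
    and inv: "\<And>p. p \<in> carrier H \<Longrightarrow> \<exists>q\<in>carrier H. q \<circ> p = id \<and> p \<circ> q = id"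
    and sub: "\<And>p i. p \<in> carrier H \<Longrightarrow> i < n \<Longrightarrow> N p i \<subseteq> {..<n}"
    and adj: "\<And>p i. p \<in> carrier H \<Longrightarrow> Suc i < n \<Longrightarrow> adjacent (N p i) (N p (Suc i))"
    and comp: "\<And>p q i x. p \<in> carrier H \<Longrightarrow> q \<in> carrier H \<Longrightarrow> i < n \<Longrightarrow> x \<in> carrier_vec n \<Longrightarrow>
      form (N p i) (vec n (\<lambda>k. form (N q k) x)) = form (N (q \<circ> p) i) x"
    and id: "\<And>i. i < n \<Longrightarrow> N id i = {i}"
    and inj: "\<And>p q. p \<in> carrier H \<Longrightarrow> q \<in> carrier H \<Longrightarrow> (\<And>i. i < n \<Longrightarrow> N p i = N q i) \<Longrightarrow> p = q"
    and surj: "\<And>S. (\<And>i. i < n \<Longrightarrow> S i \<subseteq> {..<n}) \<Longrightarrow> (\<And>i. i < n \<Longrightarrow> S i \<noteq> {}) \<Longrightarrow>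
      inj_on S {..<n} \<Longrightarrow> (\<And>i. Suc i < n \<Longrightarrow> adjacent (S i) (S (Suc i))) \<Longrightarrow>
      \<exists>p\<in>carrier H. \<forall>i<n. S i = N p i"
  shows "good_group n \<cong> H"
proof -
  interpret G: group "good_group n"
    by (rule group_good_group)
  let ?f = "\<lambda>p. row_mat n (N p)"
  have anti: "?f p * ?f q = ?f (q \<circ> p)" if "p \<in> carrier H" "q \<in> carrier H" for p q
    using that by (intro row_mat_mult) (simp_all add: sub closed comp del: o_apply)
  have one: "?f id = 1\<^sub>m n"
    by (rule eq_matI) (auto simp: row_mat_def id)
  have good: "good_mat n (?f p)" if p: "p \<in> carrier H" for p
  proof -
    obtain q where q: "q \<in> carrier H" "q \<circ> p = id" "p \<circ> q = id"
      using inv[OF p] by blast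
    \<comment> \<open>The matrix of the inverse permutation is the inverse matrix.\<close>
    have "invertible_mat (?f p)"
      using anti[OF p q(1)] anti[OF q(1) p] q one by (intro invertible_matI[of _ n "?f q"]) auto
    then show ?thesis
      using row_mat_preserves_fib_cube[of n "N p"] p sub adj by (simp add: good_mat_def)
  qed
  have "\<exists>p\<in>carrier H. A = ?f p" if A: "good_mat n A" for A
  proof -
    define S where "S = (\<lambda>i. {j. j < n \<and> A $$ (i, j) = 1})"
    have AS: "A = row_mat n S"
      using A unfolding S_def good_mat_def by (intro mat_eq_row_mat) simp
    have S: "S i \<subseteq> {..<n}" for i
      by (auto simp: S_def)
    have goodS: "good_mat n (row_mat n S)"
      using A AS by simp
    then have invS: "invertible_mat (row_mat n S)"
      by (simp add: good_mat_def)
    obtain p where "p \<in> carrier H" "\<forall>i<n. S i = N p i"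
    proof -
      have "\<exists>p\<in>carrier H. \<forall>i<n. S i = N p i"
      proof (rule surj)
        show "inj_on S {..<n}"
          using invertible_row_mat_inj[OF invS] by (auto intro: inj_onI)
      qed (use S invertible_row_mat_nonempty[OF invS] good_row_mat_adjacent[OF _ goodS] in auto)
      then show thesis
        using that by blast
    qed
    then show ?thesis
      using AS row_mat_cong[of n S "N p"] by auto
  qed
  moreover have "p = q" if "p \<in> carrier H" "q \<in> carrier H" "?f p = ?f q" for p q
    using that inj row_mat_eqD[OF that(3)] sub by metis
  ultimately have "bij_betw ?f (carrier H) (carrier (good_group n))"
    using good by (auto simp: bij_betw_def inj_on_def good_group_def)
  then show ?thesis
    by (rule G.anti_isomorphic_imp_iso) (simp_all add: mult closed anti good_group_def del: o_apply)
qed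

text \<open>Two distinct indices have at most one common neighbour in the path.\<close>

lemma singleton_of_adjacent:
  assumes "adjacent X Y" "adjacent X Z" "Y \<noteq> Z" "X \<noteq> {}" "Y \<noteq> {}" "Z \<noteq> {}"
  obtains k where "X = {k}"
proof -
  have less: False if ab: "a \<in> X" "b \<in> X" "a < b" for a b
  proof -
    have "T = {Suc a}" if "adjacent X T" "T \<noteq> {}" for T
    proof -
      have "t = Suc a" if "t \<in> T" for t
        using adjacentD[OF \<open>adjacent X T\<close> ab(1) that] adjacentD[OF \<open>adjacent X T\<close> ab(2) that] ab(3)
        by auto
      then show ?thesis
        using \<open>T \<noteq> {}\<close> by auto
    qed
    \<comment> \<open>Both \<open>Y\<close> and \<open>Z\<close> collapse to \<open>{Suc a}\<close>,
      although they differ.\<close>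
    then show False
      using assms by metis
  qed
  obtain k where "k \<in> X"
    using assms(4) by auto
  then have "a = k" if "a \<in> X" for a
    using less that by (metis linorder_neqE_nat)
  with \<open>k \<in> X\<close> have "X = {k}"
    by blast
  then show thesis
    by (rule that)
qed

lemma permutes_eqI:
  fixes p q :: "nat \<Rightarrow> nat"
  assumes "p permutes A" "q permutes A" "\<And>k. k \<in> A \<Longrightarrow> p k = q k"
  shows "p = q"
  using assms by (metis ext permutes_not_in)

section \<open>Dimension three\<close>

text \<open>The three nonzero linear forms in the two end coordinates, numbered by the points on which
  \<^const>\<open>sym_group\<close> \<open>3\<close> acts.\<close>

definition form3 :: "nat \<Rightarrow> nat set" where
  "form3 k = (if k = 1 then {0} else if k = 2 then {2} else {0, 2})"

text \<open>Points 1 and 2 stand for the end coordinates, so the end rows are their images. The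
  image of point 3 is the sum of these and takes up no row.\<close>

definition rows3 :: "(nat \<Rightarrow> nat) \<Rightarrow> nat \<Rightarrow> nat set" where
  "rows3 p i = (if i = 0 then form3 (p 1) else if i = 2 then form3 (p 2) else {1})"

lemma less_3_cases: "i < (3::nat) \<longleftrightarrow> i = 0 \<or> i = 1 \<or> i = 2"
  by auto

lemma interval_3: "{1..3::nat} = {1, 2, 3}"
  by auto

lemma permutes_3E:
  assumes "p permutes {1..3::nat}"
  obtains "p 1 = 1" "p 2 = 2" "p 3 = 3" | "p 1 = 1" "p 2 = 3" "p 3 = 2"
    | "p 1 = 2" "p 2 = 1" "p 3 = 3" | "p 1 = 2" "p 2 = 3" "p 3 = 1"
    | "p 1 = 3" "p 2 = 1" "p 3 = 2" | "p 1 = 3" "p 2 = 2" "p 3 = 1"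
proof -
  have "p 1 \<in> {1, 2, 3}" "p 2 \<in> {1, 2, 3}" "p 3 \<in> {1, 2, 3}"
    using permutes_in_image[OF assms] interval_3 by auto
  moreover have "p 1 \<noteq> p 2" "p 1 \<noteq> p 3" "p 2 \<noteq> p 3"
    using inj_eq[OF permutes_inj[OF assms]] by simp_all
  moreover have *: "a = 1 \<and> b = 2 \<and> c = 3 \<or> a = 1 \<and> b = 3 \<and> c = 2 \<or>
    a = 2 \<and> b = 1 \<and> c = 3 \<or> a = 2 \<and> b = 3 \<and> c = 1 \<or>
    a = 3 \<and> b = 1 \<and> c = 2 \<or> a = 3 \<and> b = 2 \<and> c = 1"
    if "a \<in> {1, 2, 3}" "b \<in> {1, 2, 3}" "c \<in> {1, 2, 3}" "a \<noteq> b" "a \<noteq> c" "b \<noteq> c" for a b c :: nat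
    using that by (elim insertE emptyE; simp)
  ultimately have "p 1 = 1 \<and> p 2 = 2 \<and> p 3 = 3 \<or> p 1 = 1 \<and> p 2 = 3 \<and> p 3 = 2 \<or>
    p 1 = 2 \<and> p 2 = 1 \<and> p 3 = 3 \<or> p 1 = 2 \<and> p 2 = 3 \<and> p 3 = 1 \<or>
    p 1 = 3 \<and> p 2 = 1 \<and> p 3 = 2 \<or> p 1 = 3 \<and> p 2 = 2 \<and> p 3 = 1"
    by (intro *)
  then show thesis
    using that by blast
qed

lemma form_singleton [simp]: "form {a} x = x $ a"
  by (simp add: form_def)

lemma form_doubleton [simp]: "a \<noteq> b \<Longrightarrow> form {a, b} x = x $ a + x $ b"
  by (simp only: form_def) (subst sum.insert, auto)

text \<open>In the plane spanned by the two end coordinates any two distinct nonzero forms add up to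
  the third, so the images of points 1 and 2 force the image of point 3.\<close>

lemma form_rows3:
  assumes p: "p permutes {1..3}" and k: "k \<in> {1..3}"
  shows "form (form3 k) (vec 3 (\<lambda>i. form (rows3 p i) x)) = form (form3 (p k)) x"
proof -
  define y where "y = vec 3 (\<lambda>i. form (rows3 p i) x)"
  have y: "y $ 0 = form (form3 (p 1)) x" "y $ 2 = form (form3 (p 2)) x"
    by (simp_all add: y_def rows3_def)
  have f: "form (form3 1) z = z $ 0" "form (form3 2) z = z $ 2" "form (form3 3) z = z $ 0 + z $ 2"
    for z by (simp_all add: form3_def del: add_bit_eq_xor)
  have "form (form3 (p 1)) x + form (form3 (p 2)) x = form (form3 (p 3)) x"
    using p by (rule permutes_3E) (simp_all only: f, (cases "x $ 0"; cases "x $ 2"; simp)+)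
  then have "form (form3 k) y = form (form3 (p k)) x" if "k = 1 \<or> k = 2 \<or> k = 3"
    using that by (elim disjE) (simp_all only: f y)
  then show ?thesis
    using k unfolding interval_3 y_def by simp
qed

text \<open>The middle support is a single index. It cannot be 0 or 2, whose only neighbour 1 would
  make both outer supports equal; hence it is 1, and the outer supports are distinct nonempty
  subsets of \<open>{0, 2}\<close>.\<close>

lemma rows3_classification:
  assumes sub: "\<And>i. i < 3 \<Longrightarrow> S i \<subseteq> {..<3}" and ne: "\<And>i. i < 3 \<Longrightarrow> S i \<noteq> {}"
    and inj: "inj_on S {..<3}" and adj: "\<And>i. Suc i < 3 \<Longrightarrow> adjacent (S i) (S (Suc i))"
  shows "\<exists>p. p permutes {1..3} \<and> (\<forall>i<3. S i = rows3 p i)"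
proof -
  have S: "S i \<subseteq> {0, 1, 2}" if "i < 3" for i
    using sub[OF that] by auto
  have ne02: "S 0 \<noteq> S 2"
    using inj by (auto dest: inj_onD)
  have adj1: "adjacent (S 1) (S 0)" "adjacent (S 1) (S 2)"
    using adj[of 0] adj[of 1] by (auto simp: adjacent_sym numeral_2_eq_2)
  obtain k where k: "S 1 = {k}"
    using singleton_of_adjacent[OF adj1 ne02] ne by auto
  have nbr: "t = Suc k \<or> k = Suc t" if "t \<in> S 0 \<union> S 2" for t
    using that adj1 k by (auto dest: adjacentD)
  have "k = 1"
  proof (rule ccontr)
    assume "k \<noteq> 1"
    then have "k = 0 \<or> k = 2"
      using S[of 1] k by auto
    then have "t = 1" if "t \<in> S 0 \<union> S 2" for t
      using nbr[OF that] that S[of 0] S[of 2] by auto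
    then have "S 0 = {1}" "S 2 = {1}"
      using ne[of 0] ne[of 2] by auto
    then show False
      using ne02 by simp
  qed
  have forms: "\<exists>a\<in>{1..3}. S i = form3 a" if "i = 0 \<or> i = 2" for i
  proof -
    have "t = 0 \<or> t = 2" if "t \<in> S i" for t
      using nbr[of t] that \<open>i = 0 \<or> i = 2\<close> \<open>k = 1\<close> by auto
    then have "S i \<subseteq> {0, 2}" "S i \<noteq> {}"
      using ne[of i] that by auto
    then have "S i = form3 1 \<or> S i = form3 2 \<or> S i = form3 3"
      by (auto simp: form3_def)
    then show ?thesis
      by auto
  qed
  obtain a b where ab: "a \<in> {1..3}" "b \<in> {1..3}" "S 0 = form3 a" "S 2 = form3 b"
    using forms by metis
  then have "a \<noteq> b"
    using ne02 by auto
  \<comment> \<open>Since 1 + 2 + 3 = 6, the value at 3 is the point left over by \<open>a\<close>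
    and \<open>b\<close>.\<close>
  define p where "p = (\<lambda>k::nat. if k = 1 then a else if k = 2 then b else if k = 3 then 6 - a - b else k)"
  have "bij_betw p {1..3} {1..3}"
  proof -
    have "p ` {1..3} \<subseteq> {1..3}" "inj_on p {1..3}"
      using ab(1,2) \<open>a \<noteq> b\<close> unfolding interval_3 by (auto simp: p_def inj_on_def)
    then show ?thesis
      using endo_inj_surj[of "{1..3}" p] by (auto simp: bij_betw_def)
  qed
  then have "p permutes {1..3}"
    by (rule bij_imp_permutes) (auto simp: p_def)
  moreover have "\<forall>i<3. S i = rows3 p i"
    using ab(3,4) k \<open>k = 1\<close> by (auto simp: less_3_cases rows3_def p_def)
  ultimately show ?thesis
    by blast
qed

lemma form3_inj:
  assumes "form3 a = form3 b" "a \<in> {1..3}" "b \<in> {1..3}"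
  shows "a = b"
proof -
  have "0 \<in> form3 a \<longleftrightarrow> 0 \<in> form3 b" "2 \<in> form3 a \<longleftrightarrow> 2 \<in> form3 b"
    using assms(1) by simp_all
  then show ?thesis
    using assms(2,3) by (auto simp: form3_def interval_3 split: if_splits)
qed

lemma good_group_3_iso: "good_group 3 \<cong> sym_group 3"
proof (rule good_group_iso[where N = rows3])
  fix p assume "p \<in> carrier (sym_group 3)"
  then have "p permutes {1..3}"
    by (simp add: sym_group_carrier)
  then show "\<exists>q\<in>carrier (sym_group 3). q \<circ> p = id \<and> p \<circ> q = id"
    by (intro bexI[of _ "inv' p"]) (auto simp: permutes_inv_o sym_group_carrier permutes_inv)
next
  fix p q :: "nat \<Rightarrow> nat" and i :: nat and x :: "bit vec"
  assume "p \<in> carrier (sym_group 3)" "q \<in> carrier (sym_group 3)" "i < 3"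
  then have p: "p permutes {1..3}" and q: "q permutes {1..3}" and i: "i < 3"
    by (simp_all add: sym_group_carrier)
  have "p 1 \<in> {1..3}" "p 2 \<in> {1..3}"
    using permutes_in_image[OF p] by auto
  then have *: "form (form3 (p k)) (vec 3 (\<lambda>i. form (rows3 q i) x)) = form (form3 (q (p k))) x"
    if "k = 1 \<or> k = 2" for k
    using that by (intro form_rows3[OF q]) auto
  show "form (rows3 p i) (vec 3 (\<lambda>k. form (rows3 q k) x)) = form (rows3 (q \<circ> p) i) x"
    using i *[of 1] *[of 2] by (auto simp: rows3_def less_3_cases)
next
  fix p q :: "nat \<Rightarrow> nat"
  assume "p \<in> carrier (sym_group 3)" "q \<in> carrier (sym_group 3)"
    and eq: "\<And>i. i < 3 \<Longrightarrow> rows3 p i = rows3 q i"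
  then have p: "p permutes {1..3}" and q: "q permutes {1..3}"
    by (simp_all add: sym_group_carrier)
  have "form3 (p 1) = form3 (q 1)" "form3 (p 2) = form3 (q 2)"
    using eq[of 0] eq[of 2] by (simp_all add: rows3_def)
  then have 12: "p 1 = q 1" "p 2 = q 2"
    using form3_inj permutes_in_image[OF p] permutes_in_image[OF q] by auto
  have "r 3 = 6 - r 1 - r 2" if "r permutes {1..3::nat}" for r
    using that by (rule permutes_3E) simp_all
  then have "p 3 = q 3"
    using p q 12 by metis
  with 12 have "p k = q k" if "k \<in> {1, 2, 3}" for k
    using that by auto
  then show "p = q"
    using permutes_eqI[OF p q] interval_3 by blast
next
  fix S :: "nat \<Rightarrow> nat set"
  assume "\<And>i. i < 3 \<Longrightarrow> S i \<subseteq> {..<3}" "\<And>i. i < 3 \<Longrightarrow> S i \<noteq> {}" "inj_on S {..<3}"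
    "\<And>i. Suc i < 3 \<Longrightarrow> adjacent (S i) (S (Suc i))"
  then show "\<exists>p\<in>carrier (sym_group 3). \<forall>i<3. S i = rows3 p i"
    using rows3_classification[of S] by (auto simp: sym_group_carrier)
next
  fix p :: "nat \<Rightarrow> nat" and i :: nat assume "Suc i < 3"
  then have "i = 0 \<or> i = 1"
    by auto
  then show "adjacent (rows3 p i) (rows3 p (Suc i))"
    by (auto simp: rows3_def form3_def adjacent_def)
next
  fix i :: nat assume "i < 3"
  then show "rows3 id i = {i}"
    unfolding less_3_cases by (auto simp: rows3_def form3_def)
next
  fix p :: "nat \<Rightarrow> nat" and i :: nat assume "i < 3"
  show "rows3 p i \<subseteq> {..<3}"
    by (simp add: rows3_def form3_def)
qed (simp_all add: sym_group_mult sym_group_carrier permutes_compose)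

section \<open>Dimension at least four\<close>

lemma interval_4: "{1..4::nat} = {1, 2, 3, 4}"
  by auto

text \<open>On the vertices 1 to 4 this is the diagonally opposite one.\<close>

definition opp :: "nat \<Rightarrow> nat" where
  "opp k = (if k \<le> 2 then k + 2 else k - 2)"

text \<open>A symmetry respects opposite vertices, so its values at the neighbouring vertices 1 and
  2 determine it. Off the square it is the identity, as \<open>permutes\<close> demands.\<close>

definition square_perm :: "nat \<Rightarrow> nat \<Rightarrow> nat \<Rightarrow> nat" where
  "square_perm a b k = (if k = 1 then a else if k = 2 then b else if k = 3 then opp a
     else if k = 4 then opp b else k)"

text \<open>The 4-cycle is the complete bipartite graph between odd and even vertices, so a parity
  test can replace the list of edges.\<close>

lemma square_edges_iff:
  "{a, b} \<in> square_edges \<longleftrightarrow> a \<in> {1..4} \<and> b \<in> {1..4} \<and> (odd a \<longleftrightarrow> even b)"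
proof
  assume "{a, b} \<in> square_edges"
  then show "a \<in> {1..4} \<and> b \<in> {1..4} \<and> (odd a \<longleftrightarrow> even b)"
    by (auto simp: square_edges_def doubleton_eq_iff)
next
  assume "a \<in> {1..4} \<and> b \<in> {1..4} \<and> (odd a \<longleftrightarrow> even b)"
  then show "{a, b} \<in> square_edges"
    unfolding interval_4 by (auto simp: square_edges_def insert_commute)
qed

text \<open>Only eight pairs arise. For each of them \<open>a\<close>, \<open>b\<close>,
  \<open>opp a\<close>, \<open>opp b\<close> is again a closed tour of the square, and a map of a
  finite set onto itself is injective.\<close>

lemma square_perm_in_dihedral4:
  assumes "a \<in> {1..4}" "b \<in> {1..4}" "odd a \<longleftrightarrow> even b"
  shows "square_perm a b \<in> carrier dihedral4"
proof -
  have ab: "a = 1 \<and> b = 2 \<or> a = 1 \<and> b = 4 \<or> a = 3 \<and> b = 2 \<or> a = 3 \<and> b = 4 \<or>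
    a = 2 \<and> b = 1 \<or> a = 2 \<and> b = 3 \<or> a = 4 \<and> b = 1 \<or> a = 4 \<and> b = 3"
    using assms unfolding interval_4 by auto
  have vals: "square_perm a b 1 = a" "square_perm a b 2 = b" "square_perm a b 3 = opp a"
    "square_perm a b 4 = opp b"
    by (simp_all add: square_perm_def)
  have "square_perm a b ` {1..4} = {a, b, opp a, opp b}"
    by (simp only: interval_4 image_insert image_empty vals)
  also have "\<dots> = {1..4}"
    unfolding interval_4 using ab by (elim disjE conjE) (auto simp: opp_def)
  finally have image: "square_perm a b ` {1..4} = {1..4}" .
  then have "inj_on (square_perm a b) {1..4}"
    by (intro eq_card_imp_inj_on) simp_all
  with image have "bij_betw (square_perm a b) {1..4} {1..4}"
    by (simp add: bij_betw_def)
  then have "square_perm a b permutes {1..4}"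
    by (rule bij_imp_permutes) (auto simp: square_perm_def)
  moreover have "square_perm a b ` e \<in> square_edges" if "e \<in> square_edges" for e
  proof -
    have "e = {1, 2} \<or> e = {2, 3} \<or> e = {3, 4} \<or> e = {4, 1}"
      using that by (auto simp: square_edges_def)
    then have "square_perm a b ` e = {a, b} \<or> square_perm a b ` e = {b, opp a} \<or>
      square_perm a b ` e = {opp a, opp b} \<or> square_perm a b ` e = {opp b, a}"
      by (elim disjE) (simp_all only: image_insert image_empty vals simp_thms)
    moreover have "{a, b} \<in> square_edges" "{b, opp a} \<in> square_edges"
      "{opp a, opp b} \<in> square_edges" "{opp b, a} \<in> square_edges"
      unfolding square_edges_iff using ab by (elim disjE conjE; simp add: opp_def)+
    ultimately show ?thesis
      by auto
  qed
  ultimately show ?thesis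
    by (simp add: dihedral4_def)
qed

text \<open>Edges change parity, so \<open>p 1\<close> and \<open>p 3\<close> have equal parity;
  being distinct, they are opposite. The same holds for \<open>p 2\<close> and
  \<open>p 4\<close>.\<close>

lemma dihedral4E:
  assumes "p \<in> carrier dihedral4"
  obtains a b where "a \<in> {1..4}" "b \<in> {1..4}" "odd a \<longleftrightarrow> even b" "p = square_perm a b"
proof -
  have p: "p permutes {1..4}" and e: "\<And>e. e \<in> square_edges \<Longrightarrow> p ` e \<in> square_edges"
    using assms by (auto simp: dihedral4_def)
  have in4: "p k \<in> {1..4}" if "k \<in> {1..4}" for k
    using permutes_in_image[OF p] that by blast
  have "{p 1, p 2} \<in> square_edges" "{p 2, p 3} \<in> square_edges" "{p 3, p 4} \<in> square_edges"
    using e[of "{1, 2}"] e[of "{2, 3}"] e[of "{3, 4}"] by (simp_all add: square_edges_def)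
  then have par: "odd (p 1) \<longleftrightarrow> even (p 2)" "odd (p 2) \<longleftrightarrow> even (p 3)" "odd (p 3) \<longleftrightarrow> even (p 4)"
    by (auto simp: square_edges_iff)
  have ne: "p 1 \<noteq> p 3" "p 2 \<noteq> p 4"
    using inj_eq[OF permutes_inj[OF p]] by simp_all
  have opp: "b = opp a" if "a \<in> {1..4}" "b \<in> {1..4}" "a \<noteq> b" "even a \<longleftrightarrow> even b" for a b
    using that unfolding interval_4 by (auto simp: opp_def)
  have "p 3 = opp (p 1)" "p 4 = opp (p 2)"
    using par ne in4 by (auto intro!: opp)
  then have "p k = square_perm (p 1) (p 2) k" if "k \<in> {1..4}" for k
    using that unfolding interval_4 by (auto simp: square_perm_def)
  moreover have "p k = square_perm (p 1) (p 2) k" if "k \<notin> {1..4}" for k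
    using that permutes_not_in[OF p that] by (auto simp: square_perm_def)
  ultimately have "p = square_perm (p 1) (p 2)"
    by (metis ext)
  then show thesis
    using that[of "p 1" "p 2"] in4 par by auto
qed

text \<open>Acting injectively on the finite set of edges, \<open>p\<close> permutes them, so its
  inverse maps edges to edges as well.\<close>

lemma dihedral4_inverse:
  assumes "p \<in> carrier dihedral4"
  shows "inv' p \<in> carrier dihedral4"
proof -
  have p: "p permutes {1..4}" and e: "\<And>e. e \<in> square_edges \<Longrightarrow> p ` e \<in> square_edges"
    using assms by (auto simp: dihedral4_def)
  have inj: "inj p"
    using p by (rule permutes_inj)
  have "(`) p ` square_edges = square_edges"
  proof (rule endo_inj_surj)
    show "finite square_edges"
      by (simp add: square_edges_def)
    show "(`) p ` square_edges \<subseteq> square_edges"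
      using e by blast
    show "inj_on ((`) p) square_edges"
      using inj_image_eq_iff[OF inj] by (auto intro: inj_onI)
  qed
  then have "inv' p ` e \<in> square_edges" if "e \<in> square_edges" for e
    using that inj by (metis imageE image_inv_f_f)
  then show ?thesis
    using p by (auto simp: dihedral4_def permutes_inv)
qed

lemma card_dihedral4: "card (carrier dihedral4) = 8"
proof -
  \<comment> \<open>These are the pairs of vertices of opposite parity: four choices for the first
    entry, two for the second.\<close>
  let ?P = "{1, 3} \<times> {2, 4} \<union> {2, 4} \<times> {1, 3} :: (nat \<times> nat) set"
  have "inj_on (\<lambda>(a, b). square_perm a b) ?P"
  proof (rule inj_onI, clarify)
    fix a b c d assume "square_perm a b = square_perm c d"
    then have "square_perm a b 1 = square_perm c d 1" "square_perm a b 2 = square_perm c d 2"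
      by simp_all
    then show "a = c \<and> b = d"
      by (simp add: square_perm_def)
  qed
  moreover have "carrier dihedral4 = (\<lambda>(a, b). square_perm a b) ` ?P"
  proof (intro equalityI subsetI)
    fix p assume "p \<in> carrier dihedral4"
    then obtain a b where ab: "a \<in> {1..4}" "b \<in> {1..4}" "odd a \<longleftrightarrow> even b" "p = square_perm a b"
      by (rule dihedral4E)
    then have "(a, b) \<in> ?P"
      unfolding interval_4 by auto
    then show "p \<in> (\<lambda>(a, b). square_perm a b) ` ?P"
      using ab(4) by force
  qed (auto intro!: square_perm_in_dihedral4)
  moreover have "card ?P = 8"
    by (subst card_Un_disjoint) auto
  ultimately show ?thesis
    by (simp add: card_image)
qed

section \<open>Rows attached to symmetries of the square\<close>

text \<open>The vertices of the square are the linear forms that may occur as an end row of a good matrix.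
  Its diagonals \<open>{1, 3}\<close> and \<open>{2, 4}\<close> are the two forms living at the same end.\<close>

definition end_form :: "nat \<Rightarrow> nat \<Rightarrow> nat set" where
  "end_form n k = (if k = 1 then {0} else if k = 2 then {n - 1} else if k = 3 then {0, 2}
     else {n - 1, n - 3})"

text \<open>The end rows are the images of the vertices 1 and 2, that is, of the two end
  coordinates. An odd \<open>p 1\<close> keeps the ends in place, so the interior is that of the
  identity; otherwise it is that of the reversal.\<close>

definition square_rows :: "nat \<Rightarrow> (nat \<Rightarrow> nat) \<Rightarrow> nat \<Rightarrow> nat set" where
  "square_rows n p i = (if i = 0 then end_form n (p 1) else if i = n - 1 then end_form n (p 2)
     else if odd (p 1) then {i} else {n - 1 - i})"

text \<open>Vertices 3 and 4 arise from 1 and 2 by adding the coordinate 2 or \<open>n - 3\<close>.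
  The reversal exchanges these two, and in characteristic 2 adding the one at the right end swaps a
  form with the opposite one.\<close>

lemma form_square_rows:
  assumes n: "n \<ge> 4" and p: "p \<in> carrier dihedral4" and k: "k \<in> {1..4}"
  shows "form (end_form n k) (vec n (\<lambda>i. form (square_rows n p i) x)) = form (end_form n (p k)) x"
proof -
  define y where "y = vec n (\<lambda>i. form (square_rows n p i) x)"
  obtain a b where ab: "a \<in> {1..4}" "b \<in> {1..4}" "odd a \<longleftrightarrow> even b" "p = square_perm a b"
    using p by (rule dihedral4E)
  have pv: "p 1 = a" "p 2 = b" "p 3 = opp a" "p 4 = opp b"
    by (simp_all add: ab(4) square_perm_def)
  have n': "n - 1 \<noteq> 0" "2 \<noteq> n - 1" "n - 3 \<noteq> 0" "n - 3 \<noteq> n - 1" "n - 1 < n" "n - 3 < n"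
    "n - 1 - (n - 3) = 2" "n - 1 - 2 = n - 3" "0 < n" "2 < n"
    using n by auto
  \<comment> \<open>As \<open>n \<ge> 4\<close>, rows 2 and \<open>n - 3\<close> are
    interior.\<close>
  have y: "y $ 0 = form (end_form n a) x" "y $ (n - 1) = form (end_form n b) x"
    "y $ 2 = (if odd a then x $ 2 else x $ (n - 3))" "y $ (n - 3) = (if odd a then x $ (n - 3) else x $ 2)"
    using n' by (simp_all add: y_def square_rows_def pv del: One_nat_def)
  have f: "form (end_form n 1) z = z $ 0" "form (end_form n 2) z = z $ (n - 1)"
    "form (end_form n 3) z = z $ 0 + z $ 2" "form (end_form n 4) z = z $ (n - 1) + z $ (n - 3)" for z
    using n' by (simp_all add: end_form_def del: add_bit_eq_xor)
  have o: "opp 1 = 3" "opp 2 = 4" "opp 3 = 1" "opp 4 = 2"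
    by (simp_all add: opp_def)
  have add_cancel: "u + v + v = u" for u v :: bit
    by (cases u; cases v) simp_all
  have a: "a = 1 \<or> a = 2 \<or> a = 3 \<or> a = 4" and b: "b = 1 \<or> b = 2 \<or> b = 3 \<or> b = 4"
    using ab unfolding interval_4 by simp_all
  have 3: "form (end_form n a) x + (if odd a then x $ 2 else x $ (n - 3)) = form (end_form n (opp a)) x"
    using a by (elim disjE; hypsubst) (simp_all add: f o add_cancel del: add_bit_eq_xor One_nat_def)
  have "form (end_form n b) x + (if even b then x $ (n - 3) else x $ 2) = form (end_form n (opp b)) x"
    using b by (elim disjE; hypsubst) (simp_all add: f o add_cancel del: add_bit_eq_xor One_nat_def)
  with ab(3) have 4: "form (end_form n b) x + (if odd a then x $ (n - 3) else x $ 2) = form (end_form n (opp b)) x"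
    by simp
  have "form (end_form n k) y = form (end_form n (p k)) x" if "k = 1 \<or> k = 2 \<or> k = 3 \<or> k = 4"
    using that by (elim disjE; hypsubst) (simp_all only: f y pv 3 4)
  then show ?thesis
    using k unfolding interval_4 y_def by simp
qed

section \<open>Classification of the rows in dimension at least four\<close>

text \<open>Turning around would repeat a value.\<close>

lemma path_monotone:
  fixes f :: "nat \<Rightarrow> nat"
  assumes step: "\<And>i. i < m \<Longrightarrow> f (Suc i) = Suc (f i) \<or> f i = Suc (f (Suc i))"
    and inj: "inj_on f {..m}"
  shows "(\<forall>i\<le>m. f i = f 0 + i) \<or> (\<forall>i\<le>m. f 0 = f i + i)"
  using assms
proof (induction m)
  case 0
  then show ?case by simp
next
  case (Suc m)
  \<comment> \<open>Descent is stated additively, which avoids truncated subtraction.\<close>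
  have IH: "(\<forall>i\<le>m. f i = f 0 + i) \<or> (\<forall>i\<le>m. f 0 = f i + i)"
    using Suc.prems by (intro Suc.IH) (auto intro: inj_on_subset)
  show ?case
  proof (cases m)
    case 0
    have "(\<forall>i\<le>Suc 0. P i) \<longleftrightarrow> P 0 \<and> P (Suc 0)" for P
      by (auto simp: le_Suc_eq)
    then show ?thesis
      using Suc.prems(1)[of 0] 0 by simp
  next
    case (Suc l)
    have ne: "f (Suc m) \<noteq> f l"
      using Suc.prems(2) Suc by (auto dest: inj_onD)
    have "f (Suc m) = Suc (f m) \<or> f m = Suc (f (Suc m))"
      using Suc.prems(1)[of m] by simp
    with IH show ?thesis
    proof (elim disjE)
      assume up: "\<forall>i\<le>m. f i = f 0 + i" and "f m = Suc (f (Suc m))"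
      then have "f (Suc m) = f l"
        using up[rule_format, of m] up[rule_format, of l] Suc by linarith
      then show ?thesis
        using ne by simp
    next
      assume down: "\<forall>i\<le>m. f 0 = f i + i" and "f (Suc m) = Suc (f m)"
      then have "f (Suc m) = f l"
        using down[rule_format, of m] down[rule_format, of l] Suc by linarith
      then show ?thesis
        using ne by simp
    next
      assume up: "\<forall>i\<le>m. f i = f 0 + i" and "f (Suc m) = Suc (f m)"
      then have "f (Suc m) = f 0 + Suc m"
        using up[rule_format, of m] by linarith
      then have "f i = f 0 + i" if "i \<le> Suc m" for i
        using up[rule_format, of i] that by (cases "i = Suc m") (simp, linarith)
      then show ?thesis
        by blast
    next
      assume down: "\<forall>i\<le>m. f 0 = f i + i" and "f m = Suc (f (Suc m))"
      then have "f 0 = f (Suc m) + Suc m"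
        using down[rule_format, of m] by linarith
      then have "f 0 = f i + i" if "i \<le> Suc m" for i
        using down[rule_format, of i] that by (cases "i = Suc m") (simp, linarith)
      then show ?thesis
        by blast
    qed
  qed
qed

text \<open>The interior walk starts at \<open>d\<close>. As \<open>S 0\<close> differs from
  \<open>S 2 = {Suc d}\<close>, it contains the other neighbour \<open>c\<close> of
  \<open>d\<close>; likewise \<open>S (n - 1)\<close> differs from \<open>S (n - 3)\<close> and so
  contains \<open>c + (n - 1)\<close>. This index is below \<open>n\<close>, hence
  \<open>c = 0\<close>.\<close>

lemma ascending_rows:
  assumes n: "n \<ge> 4" and S: "\<And>i. i < n \<Longrightarrow> S i \<subseteq> {..<n}" "\<And>i. i < n \<Longrightarrow> S i \<noteq> {}"
    and inj: "inj_on S {..<n}" and adj: "\<And>i. Suc i < n \<Longrightarrow> adjacent (S i) (S (Suc i))"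
    and asc: "\<And>i. i \<le> n - 3 \<Longrightarrow> S (Suc i) = {d + i}"
  shows "S 0 = {0} \<or> S 0 = {0, 2}" "S (n - 1) = {n - 1} \<or> S (n - 1) = {n - 1, n - 3}"
    "\<And>i. 0 < i \<Longrightarrow> i < n - 1 \<Longrightarrow> S i = {i}"
proof -
  have S1: "S 1 = {d}" and S2: "S 2 = {Suc d}"
    using asc[of 0] asc[of 1] n by (auto simp: numeral_2_eq_2)
  have "Suc (n - 3) = n - 2" "Suc (n - 4) = n - 3" "Suc (n - 2) = n - 1"
    using n by auto
  then have Sl: "S (n - 2) = {d + (n - 3)}" and Sl': "S (n - 3) = {d + (n - 4)}"
    using asc[of "n - 3"] asc[of "n - 4"] n by auto
  have first: "t = Suc d \<or> d = Suc t" if "t \<in> S 0" for t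
    using adjacentD[OF adj[of 0] that, of d] S1 n by auto
  have "S 0 \<noteq> {Suc d}"
    using inj_onD[OF inj, of 0 2] S2 n by auto
  moreover have "S 0 \<noteq> {}"
    using S(2) n by auto
  ultimately obtain c where c: "c \<in> S 0" "d = Suc c"
    using first by blast
  have "adjacent (S (n - 2)) (S (n - 1))"
    using adj[of "n - 2"] n \<open>Suc (n - 2) = n - 1\<close> by simp
  then have last: "t = c + (n - 1) \<or> t = c + (n - 3)" if "t \<in> S (n - 1)" for t
  proof -
    have "d + (n - 3) \<in> S (n - 2)"
      by (simp add: Sl)
    from adjacentD[OF \<open>adjacent (S (n - 2)) (S (n - 1))\<close> this that] c(2) n show ?thesis
      by linarith
  qed
  have "d + (n - 4) = c + (n - 3)"
    using c(2) n by linarith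
  then have "S (n - 1) \<noteq> {c + (n - 3)}"
    using inj_onD[OF inj, of "n - 1" "n - 3"] n Sl' by auto
  moreover have "S (n - 1) \<noteq> {}"
    using S(2)[of "n - 1"] n by simp
  ultimately have l: "c + (n - 1) \<in> S (n - 1)"
    using last by blast
  then have "c + (n - 1) < n"
    using S(1)[of "n - 1"] n by auto
  then have c0: "c = 0"
    using n by simp
  have "t = 0 \<or> t = 2" if "t \<in> S 0" for t
    using first[OF that] c(2) c0 by auto
  with c(1) c0 show "S 0 = {0} \<or> S 0 = {0, 2}"
    by blast
  have "t = n - 1 \<or> t = n - 3" if "t \<in> S (n - 1)" for t
    using last[OF that] c0 by simp
  moreover have "n - 1 \<in> S (n - 1)"
    using l c0 by simp
  ultimately show "S (n - 1) = {n - 1} \<or> S (n - 1) = {n - 1, n - 3}"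
    by blast
  show "S i = {i}" if "0 < i" "i < n - 1" for i
    using asc[of "i - 1"] that c(2) c0 by auto
qed

text \<open>The interior rows form an injective walk, which is monotone. Reading the rows from the
  bottom up reduces a descending walk to an ascending one.\<close>

lemma square_rows_classification:
  assumes n: "n \<ge> 4" and S: "\<And>i. i < n \<Longrightarrow> S i \<subseteq> {..<n}" "\<And>i. i < n \<Longrightarrow> S i \<noteq> {}"
    and inj: "inj_on S {..<n}" and adj: "\<And>i. Suc i < n \<Longrightarrow> adjacent (S i) (S (Suc i))"
  shows "\<exists>p\<in>carrier dihedral4. \<forall>i<n. S i = square_rows n p i"
proof -
  have "\<exists>k. S (Suc i) = {k}" if i: "i \<le> n - 3" for i
  proof -
    have lt: "i < n" "Suc i < n" "Suc (Suc i) < n"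
      using i n by auto
    then have "S i \<noteq> S (Suc (Suc i))"
      using inj by (auto dest: inj_onD)
    then show ?thesis
      using singleton_of_adjacent[of "S (Suc i)" "S i" "S (Suc (Suc i))"] adj[of i] adj[of "Suc i"]
        S(2)[of i] S(2)[of "Suc i"] S(2)[of "Suc (Suc i)"] lt by (metis adjacent_sym)
  qed
  \<comment> \<open>The walk is indexed from 0, so \<open>f i\<close> belongs to row
    \<open>Suc i\<close> and the last interior row has index \<open>n - 3\<close>.\<close>
  then obtain f where f: "\<And>i. i \<le> n - 3 \<Longrightarrow> S (Suc i) = {f i}"
    by metis
  have inj_f: "inj_on f {..n - 3}"
  proof (rule inj_onI)
    fix i k assume ik: "i \<in> {..n - 3}" "k \<in> {..n - 3}" "f i = f k"
    then have "S (Suc i) = S (Suc k)" "Suc i < n" "Suc k < n"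
      using f n by auto
    then show "i = k"
      using inj_onD[OF inj, of "Suc i" "Suc k"] by auto
  qed
  have step: "f (Suc i) = Suc (f i) \<or> f i = Suc (f (Suc i))" if "i < n - 3" for i
  proof -
    have "adjacent {f i} {f (Suc i)}"
      using adj[of "Suc i"] f[of i] f[of "Suc i"] that by auto
    then show ?thesis
      by (auto simp: adjacent_def)
  qed
  define R where "R = (\<lambda>i. S (n - 1 - i))"
  have R: "R i \<subseteq> {..<n}" "R i \<noteq> {}" if "i < n" for i
    using S[of "n - 1 - i"] n by (auto simp: R_def)
  have inj_R: "inj_on R {..<n}"
  proof (rule inj_onI)
    fix i k assume ik: "i \<in> {..<n}" "k \<in> {..<n}" "R i = R k"
    then have "n - 1 - i = n - 1 - k"
      using inj_onD[OF inj, of "n - 1 - i" "n - 1 - k"] n by (auto simp: R_def)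
    then show "i = k"
      using ik(1,2) by auto
  qed
  have adj_R: "adjacent (R i) (R (Suc i))" if "Suc i < n" for i
  proof -
    have "Suc (n - 1 - Suc i) = n - 1 - i"
      using that by auto
    then show ?thesis
      using adj[of "n - 1 - Suc i"] that by (simp add: R_def adjacent_sym)
  qed
  \<comment> \<open>Once both end forms and the direction are known, the permutation is the symmetry
    sending 1 to \<open>a\<close> and 2 to \<open>b\<close>.\<close>
  have witness: "\<exists>p\<in>carrier dihedral4. \<forall>i<n. S i = square_rows n p i"
    if "S 0 = end_form n a" "S (n - 1) = end_form n b" "a \<in> {1..4}" "b \<in> {1..4}" "odd a \<longleftrightarrow> even b"
      "\<And>i. 0 < i \<Longrightarrow> i < n - 1 \<Longrightarrow> S i = (if odd a then {i} else {n - 1 - i})" for a b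
  proof -
    have "S i = square_rows n (square_perm a b) i" if "i < n" for i
    proof -
      have "i = 0 \<or> i = n - 1 \<or> 0 < i \<and> i < n - 1"
        using \<open>i < n\<close> by auto
      then show ?thesis
        using \<open>S 0 = end_form n a\<close> \<open>S (n - 1) = end_form n b\<close> n
          \<open>\<And>i. 0 < i \<Longrightarrow> i < n - 1 \<Longrightarrow> S i = (if odd a then {i} else {n - 1 - i})\<close>
        by (auto simp: square_rows_def square_perm_def)
    qed
    then show ?thesis
      using square_perm_in_dihedral4[OF that(3-5)] by blast
  qed
  have vals: "end_form n 1 = {0}" "end_form n 2 = {n - 1}" "end_form n 3 = {0, 2}"
    "end_form n 4 = {n - 1, n - 3}"
    by (simp_all add: end_form_def)
  show ?thesis
    using path_monotone[OF step inj_f]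
  proof
    assume up: "\<forall>i\<le>n - 3. f i = f 0 + i"
    have asc: "S (Suc i) = {f 0 + i}" if "i \<le> n - 3" for i
      using f[OF that] up[rule_format, OF that] by simp
    note cl = ascending_rows[OF n S inj adj asc]
    obtain a where "a = 1 \<or> a = 3" "S 0 = end_form n a"
      using cl(1) vals by metis
    moreover obtain b where "b = 2 \<or> b = 4" "S (n - 1) = end_form n b"
      using cl(2) vals by metis
    ultimately show ?thesis
      using cl(3) by (intro witness[of a b]) auto
  next
    assume desc: "\<forall>i\<le>n - 3. f 0 = f i + i"
    \<comment> \<open>The reversed walk begins where \<open>f\<close> ends, at
      \<open>f (n - 3)\<close>.\<close>
    have asc: "R (Suc i) = {f (n - 3) + i}" if i: "i \<le> n - 3" for i
    proof -
      have "n - 1 - Suc i = Suc (n - 3 - i)"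
        using i n by linarith
      then have "R (Suc i) = S (Suc (n - 3 - i))"
        by (simp only: R_def)
      also have "\<dots> = {f (n - 3 - i)}"
        by (rule f) simp
      also have "f (n - 3 - i) = f (n - 3) + i"
        using desc[rule_format, of "n - 3"] desc[rule_format, of "n - 3 - i"] i by linarith
      finally show ?thesis .
    qed
    note cl = ascending_rows[OF n R inj_R adj_R asc]
    have "R 0 = S (n - 1)" "R (n - 1) = S 0"
      by (simp_all add: R_def)
    note ends = cl(1,2)[unfolded this]
    obtain a where "a = 2 \<or> a = 4" "S 0 = end_form n a"
      using ends(2) vals by metis
    moreover obtain b where "b = 1 \<or> b = 3" "S (n - 1) = end_form n b"
      using ends(1) vals by metis
    moreover have "S i = {n - 1 - i}" if "0 < i" "i < n - 1" for i
    proof -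
      have "n - 1 - (n - 1 - i) = i"
        using that by simp
      then show ?thesis
        using cl(3)[of "n - 1 - i"] that by (simp add: R_def)
    qed
    ultimately show ?thesis
      by (intro witness[of a b]) auto
  qed
qed

text \<open>Containing 0 tells the end at which a form lives, and the cardinality separates the two
  forms there.\<close>

lemma end_form_inj:
  assumes "end_form n a = end_form n b" "a \<in> {1..4}" "b \<in> {1..4}" "n \<ge> 4"
  shows "a = b"
proof -
  have "0 \<in> end_form n a \<longleftrightarrow> 0 \<in> end_form n b" "card (end_form n a) = card (end_form n b)"
    using assms(1) by simp_all
  then show ?thesis
    using assms(2-4) unfolding interval_4 by (auto simp: end_form_def split: if_splits)
qed

lemma end_form_bounded: "n \<ge> 4 \<Longrightarrow> end_form n k \<subseteq> {..<n}"
  by (auto simp: end_form_def)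

lemma good_group_iso_dihedral4:
  assumes n: "n \<ge> 4"
  shows "good_group n \<cong> dihedral4"
proof (rule good_group_iso[where N = "square_rows n"])
  show "mult dihedral4 = (\<circ>)"
    by (simp add: dihedral4_def sym_group_mult)
next
  fix p q assume pq: "p \<in> carrier dihedral4" "q \<in> carrier dihedral4"
  then have "p \<circ> q permutes {1..4}"
    by (simp add: dihedral4_def permutes_compose)
  moreover have "(p \<circ> q) ` e \<in> square_edges" if "e \<in> square_edges" for e
    using pq that unfolding image_comp[symmetric] by (simp add: dihedral4_def)
  ultimately show "p \<circ> q \<in> carrier dihedral4"
    by (simp add: dihedral4_def)
next
  fix p assume p: "p \<in> carrier dihedral4"
  then have "p permutes {1..4}"
    by (simp add: dihedral4_def)
  then show "\<exists>q\<in>carrier dihedral4. q \<circ> p = id \<and> p \<circ> q = id"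
    by (intro bexI[OF _ dihedral4_inverse[OF p]]) (auto simp: permutes_inv_o)
next
  fix p i assume "i < n"
  then show "square_rows n p i \<subseteq> {..<n}"
    using end_form_bounded[OF n] by (auto simp: square_rows_def)
next
  fix p i assume p: "p \<in> carrier dihedral4" and i: "Suc i < n"
  obtain a b where ab: "a \<in> {1..4}" "b \<in> {1..4}" "odd a \<longleftrightarrow> even b" "p = square_perm a b"
    using p by (rule dihedral4E)
  have ab': "p 1 = a" "p 2 = b"
    by (simp_all add: ab(4) square_perm_def)
  have "(a = 1 \<or> a = 3) \<and> (b = 2 \<or> b = 4) \<or> (a = 2 \<or> a = 4) \<and> (b = 1 \<or> b = 3)"
    using ab(1-3) unfolding interval_4 by auto
  moreover have "i = 0 \<or> Suc i = n - 1 \<or> 0 < i \<and> Suc i < n - 1"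
    using i by auto
  ultimately show "adjacent (square_rows n p i) (square_rows n p (Suc i))"
    using n unfolding square_rows_def ab' by (elim disjE conjE) (auto simp: end_form_def adjacent_def)
next
  fix p q :: "nat \<Rightarrow> nat" and i :: nat and x :: "bit vec"
  assume p: "p \<in> carrier dihedral4" and q: "q \<in> carrier dihedral4" and i: "i < n"
  obtain a b where ab: "a \<in> {1..4}" "b \<in> {1..4}" "odd a \<longleftrightarrow> even b" "p = square_perm a b"
    using p by (rule dihedral4E)
  obtain c d where cd: "c \<in> {1..4}" "d \<in> {1..4}" "odd c \<longleftrightarrow> even d" "q = square_perm c d"
    using q by (rule dihedral4E)
  have ab': "p 1 = a" "p 2 = b" and cd': "q 1 = c"
    by (simp_all add: ab(4) cd(4) square_perm_def)
  \<comment> \<open>A symmetry either keeps or exchanges the two diagonals, and the parity of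
    \<open>q 1\<close> decides which.\<close>
  have odd: "odd (q a) \<longleftrightarrow> (odd a \<longleftrightarrow> odd c)"
    using ab(1) cd(1-3) unfolding interval_4 cd(4) by (auto simp: square_perm_def opp_def)
  have ends: "form (end_form n k) (vec n (\<lambda>k. form (square_rows n q k) x)) = form (end_form n (q k)) x"
    if "k \<in> {1..4}" for k
    by (rule form_square_rows[OF n q that])
  show "form (square_rows n p i) (vec n (\<lambda>k. form (square_rows n q k) x)) = form (square_rows n (q \<circ> p) i) x"
  proof (cases "0 < i \<and> i < n - 1")
    case True
    \<comment> \<open>The reversal maps interior rows to interior rows and is its own
      inverse.\<close>
    then have "n - 1 - i < n" "n - 1 - (n - 1 - i) = i" "n - 1 - i \<noteq> 0" "n - 1 - i \<noteq> n - 1" "i \<noteq> 0" "i \<noteq> n - 1"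
      by auto
    then show ?thesis
      using i by (simp add: square_rows_def ab' cd' odd del: One_nat_def)
  next
    case False
    then have "i = 0 \<or> i = n - 1 \<and> n - 1 \<noteq> 0"
      using i n by auto
    then show ?thesis
      using ends[OF ab(1)] ends[OF ab(2)] by (elim disjE) (simp_all add: square_rows_def[of n p] square_rows_def[of n "q \<circ> p"] ab' del: One_nat_def)
  qed
next
  fix i assume "i < n"
  then show "square_rows n id i = {i}"
    by (auto simp: square_rows_def end_form_def)
next
  fix p q assume p: "p \<in> carrier dihedral4" and q: "q \<in> carrier dihedral4"
    and eq: "\<And>i. i < n \<Longrightarrow> square_rows n p i = square_rows n q i"
  obtain a b where ab: "a \<in> {1..4}" "b \<in> {1..4}" "p = square_perm a b"
    using p by (rule dihedral4E)
  obtain c d where cd: "c \<in> {1..4}" "d \<in> {1..4}" "q = square_perm c d"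
    using q by (rule dihedral4E)
  have "end_form n a = end_form n c" "end_form n b = end_form n d"
    using eq[of 0] eq[of "n - 1"] n by (simp_all add: square_rows_def ab(3) cd(3) square_perm_def)
  then have "a = c" "b = d"
    using end_form_inj n ab cd by auto
  then show "p = q"
    by (simp add: ab(3) cd(3))
next
  fix S :: "nat \<Rightarrow> nat set"
  assume "\<And>i. i < n \<Longrightarrow> S i \<subseteq> {..<n}" "\<And>i. i < n \<Longrightarrow> S i \<noteq> {}" "inj_on S {..<n}"
    "\<And>i. Suc i < n \<Longrightarrow> adjacent (S i) (S (Suc i))"
  then show "\<exists>p\<in>carrier dihedral4. \<forall>i<n. S i = square_rows n p i"
    by (rule square_rows_classification[OF n])
qed

theorem theorem1:
  shows "(\<forall>n::nat. n \<ge> 4 \<longrightarrow>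
            card {A. good_mat n A} = 8 \<and> group (good_group n) \<and> good_group n \<cong> dihedral4)
       \<and> (card {A. good_mat 3 A} = 6 \<and> group (good_group 3) \<and> good_group 3 \<cong> sym_group 3)"
proof -
  have carrier: "carrier (good_group n) = {A. good_mat n A}" for n
    by (simp add: good_group_def)
  have "card (carrier (sym_group 3)) = 6"
    using card_permutations[of "{1..3::nat}" 3] by (simp add: sym_group_def fact_numeral)
  then show ?thesis
    using iso_same_card[OF good_group_iso_dihedral4] iso_same_card[OF good_group_3_iso]
      good_group_iso_dihedral4 good_group_3_iso group_good_group card_dihedral4
    by (simp add: carrier)
qed

end
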